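(* For $n\ge2$ let $G_n=(V_n,E_n)$ be the undirected graph with vertex set $V_n=(\mathbb{Z}/n\mathbb{Z})^2$ in which every $(x,y)\in V_n$ is joined by an edge to each of $(x,y\pm1)$, $(x\pm1,y)$, $(x,y\pm x)$, $(x\pm y,y)$, with arithmetic modulo $n$. There is a constant $c>0$ such that for every $n\ge2$, $$\lambda_2(G_n)\ge c.$$ In other words, $\{G_n\}$ forms an expander family.
   Context: For a finite graph $G=(V,E)$, $\lambda_2(G)$ is the minimum of $\frac{\sum_{\{u,v\}\in E}|f(u)-f(v)|^2}{\sum_{u\in V}|f(u)|^2}$ over nonzero $f:V\to\mathbb{C}$ with $\sum_{u\in V}f(u)=0$. An infinite family $\{G_n\}$ of finite graphs with uniformly bounded degrees is an expander family if there is a constant $c>0$ with $\lambda_2(G_n)\ge c$ for all $n$. *)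

theory Defs
  imports Complex_Main
begin

text \<open>An edge is the set of its endpoints, so a loop is a singleton and there are no
  multiple edges.\<close>

record 'a ugraph =
  verts :: "'a set"
  edges :: "'a set set"

definition finite_graph :: "'a ugraph \<Rightarrow> bool" where
  "finite_graph G \<longleftrightarrow>
     finite (verts G) \<and> (\<forall>e\<in>edges G. \<exists>u\<in>verts G. \<exists>v\<in>verts G. e = {u, v})"

text \<open>A loop counts once; counting it twice would change degrees by at most 1.\<close>

definition degree :: "'a ugraph \<Rightarrow> 'a \<Rightarrow> nat" where
  "degree G u = card {e \<in> edges G. u \<in> e}"

definition edge_sqdiff :: "('a \<Rightarrow> complex) \<Rightarrow> 'a set \<Rightarrow> real" where
  "edge_sqdiff f e = (THE d. \<exists>u v. e = {u, v} \<and> d = (cmod (f u - f v))\<^sup>2)"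

lemma edge_sqdiff_doubleton: "edge_sqdiff f {u, v} = (cmod (f u - f v))\<^sup>2"
  unfolding edge_sqdiff_def
  by (rule the_equality) (auto simp: doubleton_eq_iff norm_minus_commute)

definition rayleigh :: "'a ugraph \<Rightarrow> ('a \<Rightarrow> complex) \<Rightarrow> real" where
  "rayleigh G f = (\<Sum>e\<in>edges G. edge_sqdiff f e) / (\<Sum>u\<in>verts G. (cmod (f u))\<^sup>2)"

text \<open>The minimum of the quotient is its least value, which exists for every finite graph with
  at least two vertices. Only the values of \<open>f\<close> on the vertex set matter.\<close>

definition lambda2 :: "'a ugraph \<Rightarrow> real" where
  "lambda2 G = (LEAST q. \<exists>f. (\<exists>u\<in>verts G. f u \<noteq> 0) \<and> (\<Sum>u\<in>verts G. f u) = 0 \<and>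
                             q = rayleigh G f)"

text \<open>Graphs with fewer than two vertices are excluded because for them the minimum
  defining \<^const>\<open>lambda2\<close> ranges over the empty set.\<close>

definition expander_family :: "'i set \<Rightarrow> ('i \<Rightarrow> 'a ugraph) \<Rightarrow> bool" where
  "expander_family I G \<longleftrightarrow>
     infinite (G ` I) \<and>
     (\<forall>i\<in>I. finite_graph (G i) \<and> 2 \<le> card (verts (G i))) \<and>
     (\<exists>d. \<forall>i\<in>I. \<forall>u\<in>verts (G i). degree (G i) u \<le> d) \<and>
     (\<exists>c>0. \<forall>i\<in>I. c \<le> lambda2 (G i))"

text \<open>Residue classes modulo \<open>n\<close> are represented by \<open>0, \<dots>, n - 1\<close>.\<close>

definition torus_verts :: "nat \<Rightarrow> (int \<times> int) set" where
  "torus_verts n = {0..<int n} \<times> {0..<int n}"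

definition torus_nbrs :: "nat \<Rightarrow> int \<times> int \<Rightarrow> (int \<times> int) set" where
  "torus_nbrs n = (\<lambda>(x, y).
     {(x, (y + 1) mod int n), (x, (y - 1) mod int n),
      ((x + 1) mod int n, y), ((x - 1) mod int n, y),
      (x, (y + x) mod int n), (x, (y - x) mod int n),
      ((x + y) mod int n, y), ((x - y) mod int n, y)})"

definition torus_graph :: "nat \<Rightarrow> (int \<times> int) ugraph" where
  "torus_graph n =
     \<lparr>verts = torus_verts n,
      edges = {{p, q} | p q. p \<in> torus_verts n \<and> q \<in> torus_nbrs n p}\<rparr>"

end

theory Submission
  imports Defs "HOL-Analysis.Function_Topology" "HOL-Analysis.Topology_Euclidean_Space"
begin

text \<open>
  The discrete Fourier transform on \<open>(\<int>/n\<int>)\<^sup>2\<close> turns the translations into multiplication by characters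
  and each shear into the other one. With \<open>G = \<bar>F\<bar>\<close> for the transform \<open>F\<close> of \<open>f\<close>, the energy of \<open>f\<close> therefore
  controls \<open>G\<^sup>2\<close> at all frequencies with a coordinate of absolute value at least \<open>n/4\<close>, where a character
  is far from 1, as well as the sum of \<open>(G z - G (T z))\<^sup>2\<close> for both shears \<open>T\<close>; moreover \<open>G (0, 0) = 0\<close>.
  At the remaining nonzero frequencies the shears act as on \<open>\<int>\<^sup>2\<close>, and there
  \<open>2 G(z) G(z') \<le> w(z, z') G(z)\<^sup>2 + w(z', z) G(z')\<^sup>2\<close> for weights with \<open>w(z, z') w(z', z) = 1\<close> whose sum over
  the four neighbours of any nonzero point is at most \<open>23/6 < 4\<close>. This is a spectral gap for the
  shears near the origin.
\<close>

section \<open>A weight on the shear graph of the integer lattice\<close>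

text \<open>A generic point has two neighbours of larger, one of equal and one of smaller maximum norm,
  and \<open>2/3 + 2/3 + 1 + 3/2 = 23/6\<close>. The norm alone fails on the axes, where all four neighbours have
  equal norm, so axis points are given weight \<open>5/6\<close> towards their two diagonal neighbours; the
  resulting \<open>6/5\<close> in the other direction is affordable on the diagonals, with sum \<open>2/3 + 2/3 + 6/5 + 6/5\<close>.\<close>

definition wt :: "int \<times> int \<Rightarrow> int \<times> int \<Rightarrow> real" where
  "wt p q = (let M = (\<lambda>(a, b). max \<bar>a\<bar> \<bar>b\<bar>); axis = (\<lambda>(a, b). a = 0 \<or> b = 0) in
     if M p < M q then 2/3 else if M q < M p then 3/2
     else if axis p \<and> \<not> axis q then 5/6 else if axis q \<and> \<not> axis p then 6/5 else 1)"

lemma wt_pos: "0 < wt p q" and wt_le: "wt p q \<le> 3/2" and wt_swap: "wt p q * wt q p = 1"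
  by (auto simp: wt_def Let_def)

lemma wt_up: "max \<bar>a\<bar> \<bar>b\<bar> < max \<bar>c\<bar> \<bar>d\<bar> \<Longrightarrow> wt (a, b) (c, d) = 2/3"
  by (simp only: wt_def Let_def prod.case if_True)

lemma wt_down: "max \<bar>c\<bar> \<bar>d\<bar> < max \<bar>a\<bar> \<bar>b\<bar> \<Longrightarrow> wt (a, b) (c, d) = 3/2"
  by (simp add: wt_def Let_def del: max_less_iff_conj)

lemma wt_same:
  "max \<bar>a\<bar> \<bar>b\<bar> = max \<bar>c\<bar> \<bar>d\<bar> \<Longrightarrow> wt (a, b) (c, d) =
     (if (a = 0 \<or> b = 0) \<and> \<not> (c = 0 \<or> d = 0) then 5/6
      else if (c = 0 \<or> d = 0) \<and> \<not> (a = 0 \<or> b = 0) then 6/5 else 1)"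
  by (simp only: wt_def Let_def prod.case less_irrefl if_False)

text \<open>Shifting the larger coordinate by the smaller gives absolute values
  \<open>|a| + |b|\<close> and \<open>|a| - |b|\<close>, so the norm rises once and falls once.
  Shifting the smaller by the larger gives one rise and one equal norm, with both points off the
  axes. The last two clauses are the mirror image.\<close>

lemma wt_sum_strict:
  assumes "b \<noteq> 0" "\<bar>b\<bar> < \<bar>a\<bar>"
  shows "wt (a, b) (a + b, b) + wt (a, b) (a - b, b) = 2/3 + 3/2"
    and "wt (a, b) (a, b + a) + wt (a, b) (a, b - a) = 2/3 + 1"
    and "wt (b, a) (b, a + b) + wt (b, a) (b, a - b) = 2/3 + 3/2"
    and "wt (b, a) (b + a, a) + wt (b, a) (b - a, a) = 2/3 + 1"
proof -
  consider "\<bar>a + b\<bar> = \<bar>a\<bar> + \<bar>b\<bar>" "\<bar>a - b\<bar> = \<bar>a\<bar> - \<bar>b\<bar>" "\<bar>b - a\<bar> = \<bar>a\<bar> - \<bar>b\<bar>"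
    | "\<bar>a + b\<bar> = \<bar>a\<bar> - \<bar>b\<bar>" "\<bar>a - b\<bar> = \<bar>a\<bar> + \<bar>b\<bar>" "\<bar>b - a\<bar> = \<bar>a\<bar> + \<bar>b\<bar>"
    using assms by linarith
  note cases = this
  have [simp]: "b + a = a + b" "a \<noteq> 0" "b \<noteq> 0" "a \<noteq> b" "b \<noteq> a" "a + b \<noteq> 0" "a - b \<noteq> 0" "b - a \<noteq> 0"
    "max \<bar>a\<bar> \<bar>b\<bar> = \<bar>a\<bar>" "max \<bar>b\<bar> \<bar>a\<bar> = \<bar>a\<bar>" "\<bar>b\<bar> < \<bar>a\<bar>" "0 < \<bar>b\<bar>"
    using assms by auto
  have m: "max \<bar>a\<bar> (\<bar>a\<bar> + \<bar>b\<bar>) = \<bar>a\<bar> + \<bar>b\<bar>" "max (\<bar>a\<bar> + \<bar>b\<bar>) \<bar>a\<bar> = \<bar>a\<bar> + \<bar>b\<bar>"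
    "max \<bar>b\<bar> (\<bar>a\<bar> + \<bar>b\<bar>) = \<bar>a\<bar> + \<bar>b\<bar>" "max (\<bar>a\<bar> + \<bar>b\<bar>) \<bar>b\<bar> = \<bar>a\<bar> + \<bar>b\<bar>"
    "max \<bar>a\<bar> (\<bar>a\<bar> - \<bar>b\<bar>) = \<bar>a\<bar>" "max (\<bar>a\<bar> - \<bar>b\<bar>) \<bar>a\<bar> = \<bar>a\<bar>"
    "max \<bar>b\<bar> (\<bar>a\<bar> - \<bar>b\<bar>) < \<bar>a\<bar>" "max (\<bar>a\<bar> - \<bar>b\<bar>) \<bar>b\<bar> < \<bar>a\<bar>"
    using assms by auto
  show "wt (a, b) (a + b, b) + wt (a, b) (a - b, b) = 2/3 + 3/2"
    by (rule cases) (simp_all add: wt_up wt_down m)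
  show "wt (a, b) (a, b + a) + wt (a, b) (a, b - a) = 2/3 + 1"
    by (rule cases) (simp_all add: wt_up wt_same m)
  show "wt (b, a) (b, a + b) + wt (b, a) (b, a - b) = 2/3 + 3/2"
    by (rule cases) (simp_all add: wt_up wt_down m)
  show "wt (b, a) (b + a, a) + wt (b, a) (b - a, a) = 2/3 + 1"
    by (rule cases) (simp_all add: wt_up wt_same m)
qed

text \<open>An axis point is its own neighbour twice and has sum \<open>1 + 1 + 5/6 + 5/6\<close>;
  axis and diagonal points stay strictly below the bound, generic ones attain it. At the origin,
  fixed by all shears, the sum would be 4.\<close>

lemma wt_sum_le:
  assumes "(a, b) \<noteq> (0, 0)"
  shows "wt (a, b) (a + b, b) + wt (a, b) (a - b, b) + wt (a, b) (a, b + a) + wt (a, b) (a, b - a)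
    \<le> 23/6"
proof -
  consider "a = 0" | "b = 0" | "a = b" "a \<noteq> 0" | "a = - b" "a \<noteq> 0"
    | "a \<noteq> 0" "\<bar>a\<bar> < \<bar>b\<bar>" | "b \<noteq> 0" "\<bar>b\<bar> < \<bar>a\<bar>" by linarith
  then show ?thesis
  proof cases
    case 1
    then show ?thesis using assms by (simp add: wt_same)
  next
    case 2
    then show ?thesis using assms by (simp add: wt_same)
  next
    case 3
    then show ?thesis by (simp add: wt_same wt_up)
  next
    case 4
    then have "\<bar>- b - b\<bar> = 2 * \<bar>b\<bar>" "\<bar>b - - b\<bar> = 2 * \<bar>b\<bar>" "b \<noteq> 0" by auto
    then show ?thesis using 4 by (simp add: wt_same wt_up max_def)
  next
    case 5
    show ?thesis using wt_sum_strict(3,4)[OF 5] by simp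
  next
    case 6
    show ?thesis using wt_sum_strict(1,2)[OF 6] by simp
  qed
qed

lemma weighted_am_gm:
  fixes s t x y :: real
  assumes "s > 0" "s * t = 1"
  shows "2 * x * y \<le> s * x\<^sup>2 + t * y\<^sup>2"
proof -
  have t: "t = 1 / s" using assms by (simp add: field_simps)
  have "s * x\<^sup>2 + t * y\<^sup>2 - 2 * x * y = (s * x - y)\<^sup>2 / s"
    using assms by (simp add: t field_simps power2_eq_square)
  also have "\<dots> \<ge> 0" using assms by simp
  finally show ?thesis by simp
qed

section \<open>The shear energy on the torus\<close>

text \<open>For \<open>n > 0\<close> this is the representative in \<open>(-n/2, n/2]\<close>; it
  lifts frequencies to the integer lattice.\<close>

definition centred :: "nat \<Rightarrow> int \<Rightarrow> int" where
  "centred n x = (if 2 * (x mod int n) \<le> int n then x mod int n else x mod int n - int n)"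

lemma centred_eq: "2 * \<bar>a\<bar> < int n \<Longrightarrow> centred n a = a"
proof -
  assume a: "2 * \<bar>a\<bar> < int n"
  show ?thesis
  proof (cases "a \<ge> 0")
    case True
    then show ?thesis using a by (simp add: centred_def)
  next
    case False
    have "a mod int n = (a + int n) mod int n" by simp
    also have "\<dots> = a + int n" using a False by (intro mod_pos_pos_trivial) auto
    finally have "a mod int n = a + int n" .
    then show ?thesis using a False by (simp add: centred_def)
  qed
qed

lemma centred_mod [simp]: "centred n (x mod int n) = centred n x"
  by (simp add: centred_def)

lemma mod_centred [simp]: "centred n x mod int n = x mod int n"
  by (simp add: centred_def)


section \<open>Shears and translations as permutations of the torus\<close>

definition hshear :: "nat \<Rightarrow> int \<Rightarrow> int \<times> int \<Rightarrow> int \<times> int" where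
  "hshear n k = (\<lambda>(x, y). ((x + k * y) mod int n, y))"

definition vshear :: "nat \<Rightarrow> int \<Rightarrow> int \<times> int \<Rightarrow> int \<times> int" where
  "vshear n k = (\<lambda>(x, y). (x, (y + k * x) mod int n))"

definition htrans :: "nat \<Rightarrow> int \<Rightarrow> int \<times> int \<Rightarrow> int \<times> int" where
  "htrans n k = (\<lambda>(x, y). ((x + k) mod int n, y))"

definition vtrans :: "nat \<Rightarrow> int \<Rightarrow> int \<times> int \<Rightarrow> int \<times> int" where
  "vtrans n k = (\<lambda>(x, y). (x, (y + k) mod int n))"

lemmas torus_maps = hshear_def vshear_def htrans_def vtrans_def

lemma finite_torus_verts [simp]: "finite (torus_verts n)"
  by (simp add: torus_verts_def)

lemma torus_maps_inverse:
  assumes "z \<in> torus_verts n"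
  shows "hshear n (- k) (hshear n k z) = z" "vshear n (- k) (vshear n k z) = z"
    "htrans n (- k) (htrans n k z) = z" "vtrans n (- k) (vtrans n k z) = z"
  using assms by (auto simp: torus_maps torus_verts_def mod_simps)

lemma torus_maps_closed:
  assumes "z \<in> torus_verts n"
  shows "hshear n k z \<in> torus_verts n" "vshear n k z \<in> torus_verts n"
    "htrans n k z \<in> torus_verts n" "vtrans n k z \<in> torus_verts n"
  using assms by (auto simp: torus_maps torus_verts_def)

lemma torus_maps_bij:
  "bij_betw (hshear n k) (torus_verts n) (torus_verts n)"
  "bij_betw (vshear n k) (torus_verts n) (torus_verts n)"
  "bij_betw (htrans n k) (torus_verts n) (torus_verts n)"
  "bij_betw (vtrans n k) (torus_verts n) (torus_verts n)"
proof -
  note [simp] = torus_maps_inverse torus_maps_closed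
    torus_maps_inverse[of _ n "- k", unfolded minus_minus]
  show "bij_betw (hshear n k) (torus_verts n) (torus_verts n)"
    by (rule bij_betw_byWitness[where f' = "hshear n (- k)"]) auto
  show "bij_betw (vshear n k) (torus_verts n) (torus_verts n)"
    by (rule bij_betw_byWitness[where f' = "vshear n (- k)"]) auto
  show "bij_betw (htrans n k) (torus_verts n) (torus_verts n)"
    by (rule bij_betw_byWitness[where f' = "htrans n (- k)"]) auto
  show "bij_betw (vtrans n k) (torus_verts n) (torus_verts n)"
    by (rule bij_betw_byWitness[where f' = "vtrans n (- k)"]) auto
qed

text \<open>Expand the square and bound the cross term by the weighted AM-GM inequality. Reindexing
  along \<open>T\<close> turns the weight \<open>w (T z) z\<close> at \<open>T z\<close> into
  \<open>w z (S z)\<close> at \<open>z\<close>, which leaves a pointwise coefficient.\<close>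

lemma weighted_energy_ge:
  fixes G :: "'a \<Rightarrow> real" and w :: "'a \<Rightarrow> 'a \<Rightarrow> real"
  assumes T: "bij_betw T V V" and S: "\<And>z. z \<in> V \<Longrightarrow> S (T z) = z"
    and w: "\<And>p q. w p q > 0" "\<And>p q. w p q * w q p = 1"
  shows "(\<Sum>z\<in>V. (2 - w z (T z) - w z (S z)) * (G z)\<^sup>2) \<le> (\<Sum>z\<in>V. (G z - G (T z))\<^sup>2)"
proof -
  have 1: "(\<Sum>z\<in>V. w (T z) z * (G (T z))\<^sup>2) = (\<Sum>z\<in>V. w z (S z) * (G z)\<^sup>2)"
    using sum.reindex_bij_betw[OF T, of "\<lambda>z. w z (S z) * (G z)\<^sup>2"] by (simp add: S cong: sum.cong)
  have 2: "(\<Sum>z\<in>V. (G (T z))\<^sup>2) = (\<Sum>z\<in>V. (G z)\<^sup>2)"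
    using sum.reindex_bij_betw[OF T, of "\<lambda>z. (G z)\<^sup>2"] by simp
  have "(\<Sum>z\<in>V. 2 * G z * G (T z)) \<le> (\<Sum>z\<in>V. w z (T z) * (G z)\<^sup>2 + w (T z) z * (G (T z))\<^sup>2)"
    by (intro sum_mono weighted_am_gm w)
  then have "(\<Sum>z\<in>V. 2 * G z * G (T z)) \<le> (\<Sum>z\<in>V. (w z (T z) + w z (S z)) * (G z)\<^sup>2)"
    by (simp add: sum.distrib 1 distrib_right)
  moreover have "(\<Sum>z\<in>V. (G z - G (T z))\<^sup>2) = 2 * (\<Sum>z\<in>V. (G z)\<^sup>2) - (\<Sum>z\<in>V. 2 * G z * G (T z))"
    by (simp add: power2_diff sum.distrib sum_subtractf 2)
  moreover have "(\<Sum>z\<in>V. (2 - w z (T z) - w z (S z)) * (G z)\<^sup>2)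
      = 2 * (\<Sum>z\<in>V. (G z)\<^sup>2) - (\<Sum>z\<in>V. (w z (T z) + w z (S z)) * (G z)\<^sup>2)"
    by (simp add: left_diff_distrib distrib_right sum_subtractf sum.distrib sum_distrib_left)
  ultimately show ?thesis by linarith
qed

text \<open>The threshold \<open>n/4\<close> serves twice: below it, shears do not wrap around; from
  it on, a character value has nonpositive real part.\<close>

definition far :: "nat \<Rightarrow> int \<times> int \<Rightarrow> bool" where
  "far n = (\<lambda>(x, y). int n \<le> 4 * \<bar>centred n x\<bar> \<or> int n \<le> 4 * \<bar>centred n y\<bar>)"

text \<open>Two coordinates below \<open>n/4\<close> in absolute value have sum and differences
  below \<open>n/2\<close>, so \<open>centred\<close> commutes with the shears and the lattice bound
  applies.\<close>

lemma wt_sum_torus_le: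
  assumes "z \<in> torus_verts n" "z \<noteq> (0, 0)" "\<not> far n z"
  defines "w \<equiv> \<lambda>p q. wt (map_prod (centred n) (centred n) p) (map_prod (centred n) (centred n) q)"
  shows "w z (hshear n 1 z) + w z (hshear n (- 1) z) + w z (vshear n 1 z) + w z (vshear n (- 1) z)
    \<le> 23/6"
proof -
  obtain x y where z: "z = (x, y)" by force
  define a b where "a = centred n x" and "b = centred n y"
  have ab: "4 * \<bar>a\<bar> < int n" "4 * \<bar>b\<bar> < int n"
    using assms(3) by (auto simp: far_def z a_def b_def)
  have xy: "x = a mod int n" "y = b mod int n"
    using assms(1) by (auto simp: z a_def b_def torus_verts_def)
  have "(a, b) \<noteq> (0, 0)"
    using assms(2) by (auto simp: z xy)
  moreover have "centred n (a + b) = a + b" "centred n (a - b) = a - b" "centred n (b + a) = b + a"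
    "centred n (b - a) = b - a" "centred n a = a" "centred n b = b"
    using ab abs_triangle_ineq[of a b] abs_triangle_ineq4[of a b] abs_triangle_ineq4[of b a]
    by (auto intro!: centred_eq simp: add.commute)
  ultimately show ?thesis
    using wt_sum_le[of a b] by (simp add: w_def z xy hshear_def vshear_def mod_simps)
qed

lemma shear_energy_ge:
  fixes G :: "int \<times> int \<Rightarrow> real" and n :: nat
  assumes "G (0, 0) = 0"
  defines "V \<equiv> torus_verts n"
  shows "(\<Sum>z\<in>V. (G z)\<^sup>2) \<le> 6 * (\<Sum>z\<in>V. (G z - G (hshear n 1 z))\<^sup>2)
    + 6 * (\<Sum>z\<in>V. (G z - G (vshear n 1 z))\<^sup>2) + 13 * (\<Sum>z\<in>V. of_bool (far n z) * (G z)\<^sup>2)"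
proof -
  define w where
    "w = (\<lambda>p q. wt (map_prod (centred n) (centred n) p) (map_prod (centred n) (centred n) q))"
  have w: "w p q > 0" "w p q * w q p = 1" "w p q \<le> 3/2" for p q
    unfolding w_def by (rule wt_pos wt_swap wt_le)+
  have H: "(\<Sum>z\<in>V. (2 - w z (hshear n 1 z) - w z (hshear n (- 1) z)) * (G z)\<^sup>2)
      \<le> (\<Sum>z\<in>V. (G z - G (hshear n 1 z))\<^sup>2)"
    unfolding V_def by (intro weighted_energy_ge torus_maps_bij torus_maps_inverse w)
  have K: "(\<Sum>z\<in>V. (2 - w z (vshear n 1 z) - w z (vshear n (- 1) z)) * (G z)\<^sup>2)
      \<le> (\<Sum>z\<in>V. (G z - G (vshear n 1 z))\<^sup>2)"
    unfolding V_def by (intro weighted_energy_ge torus_maps_bij torus_maps_inverse w)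
  have "(G z)\<^sup>2 \<le> 6 * ((2 - w z (hshear n 1 z) - w z (hshear n (- 1) z)) * (G z)\<^sup>2)
      + 6 * ((2 - w z (vshear n 1 z) - w z (vshear n (- 1) z)) * (G z)\<^sup>2)
      + 13 * (of_bool (far n z) * (G z)\<^sup>2)" if "z \<in> V" for z
  proof (cases "z = (0, 0)")
    case False
    let ?s = "w z (hshear n 1 z) + w z (hshear n (- 1) z) + w z (vshear n 1 z) + w z (vshear n (- 1) z)"
    \<comment> \<open>Near the origin \<open>6 * (4 - 23/6) = 1\<close>. At far points only
      \<open>?s \<le> 6\<close> is known, and \<open>6 * (4 - 6) + 13 = 1\<close>.\<close>
    have "1 \<le> 6 * (4 - ?s) + 13 * of_bool (far n z)"
    proof (cases "far n z")
      case True
      have "?s \<le> 3/2 + 3/2 + 3/2 + 3/2"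
        by (intro add_mono w)
      then show ?thesis using True by simp
    next
      case far: False
      show ?thesis
        using wt_sum_torus_le[OF _ False far] that far by (simp add: V_def w_def)
    qed
    from mult_right_mono[OF this, of "(G z)\<^sup>2"] show ?thesis
      by (simp add: algebra_simps)
  qed (simp add: assms)
  then have "(\<Sum>z\<in>V. (G z)\<^sup>2) \<le> (\<Sum>z\<in>V.
        6 * ((2 - w z (hshear n 1 z) - w z (hshear n (- 1) z)) * (G z)\<^sup>2)
      + 6 * ((2 - w z (vshear n 1 z) - w z (vshear n (- 1) z)) * (G z)\<^sup>2)
      + 13 * (of_bool (far n z) * (G z)\<^sup>2))"
    by (rule sum_mono)
  also have "\<dots> = 6 * (\<Sum>z\<in>V. (2 - w z (hshear n 1 z) - w z (hshear n (- 1) z)) * (G z)\<^sup>2)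
      + 6 * (\<Sum>z\<in>V. (2 - w z (vshear n 1 z) - w z (vshear n (- 1) z)) * (G z)\<^sup>2)
      + 13 * (\<Sum>z\<in>V. of_bool (far n z) * (G z)\<^sup>2)"
    by (simp only: sum.distrib sum_distrib_left)
  finally show ?thesis using H K by linarith
qed


section \<open>The discrete Fourier transform\<close>

definition root_char :: "nat \<Rightarrow> int \<Rightarrow> complex" where
  "root_char n k = cis (2 * pi * of_int k / of_nat n)"

lemma root_char_0 [simp]: "root_char n 0 = 1"
  by (simp add: root_char_def)

lemma root_char_add: "root_char n (k + l) = root_char n k * root_char n l"
  by (simp add: root_char_def cis_mult distrib_left add_divide_distrib)

lemma cnj_root_char: "cnj (root_char n k) = root_char n (- k)"
  by (simp add: root_char_def cis_cnj)

lemma root_char_mult_n: "root_char n (m * int n) = 1"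
proof (cases "n = 0")
  case False
  then have "2 * pi * of_int (m * int n) / of_nat n = 2 * pi * of_int m" by simp
  then show ?thesis
    using cis_multiple_2pi[of "of_int m"] by (simp add: root_char_def)
\<comment> \<open>For \<open>n = 0\<close> the quotient in the angle is 0 by convention, so
  \<open>root_char\<close> is constantly 1.\<close>
qed (simp add: root_char_def)

lemma root_char_cong: "k mod int n = l mod int n \<Longrightarrow> root_char n k = root_char n l"
proof -
  have *: "root_char n k = root_char n (k mod int n)" for k
    using root_char_add[of n "k div int n * int n" "k mod int n"] by (simp add: root_char_mult_n)
  show "k mod int n = l mod int n \<Longrightarrow> root_char n k = root_char n l"
    using *[of k] *[of l] by simp
qed

lemma root_char_mult_mod:
  "root_char n (a * (b mod int n)) = root_char n (a * b)"
  "root_char n ((b mod int n) * a) = root_char n (b * a)"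
  by (rule root_char_cong, simp add: mod_simps)+

lemma root_char_eq_1_iff:
  assumes "n > 0"
  shows "root_char n k = 1 \<longleftrightarrow> int n dvd k"
proof
  assume "root_char n k = 1"
  then have "cos (2 * pi * of_int k / of_nat n) = 1"
    by (simp add: root_char_def complex_eq_iff)
  then obtain m :: int where "2 * pi * of_int k / of_nat n = of_int m * (2 * pi)"
    by (auto simp: cos_one_2pi_int)
  then have "of_int k = (of_int (m * int n) :: real)"
    using assms by (simp add: field_simps)
  then show "int n dvd k" by (simp only: of_int_eq_iff) simp
next
  assume "int n dvd k"
  then show "root_char n k = 1"
    using root_char_cong[of k n 0] by simp
qed

text \<open>The cyclic shift of \<open>a\<close> by 1 multiplies the sum by
  \<open>root_char n k\<close>; if that factor is not 1, the sum vanishes.\<close>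

lemma sum_root_char:
  assumes "n > 0"
  shows "(\<Sum>a\<in>{0..<int n}. root_char n (a * k)) = (if int n dvd k then of_nat n else 0)"
proof (cases "int n dvd k")
  case True
  then have "root_char n (a * k) = 1" for a using assms by (simp add: root_char_eq_1_iff)
  then show ?thesis using True by simp
next
  case False
  let ?S = "\<Sum>a\<in>{0..<int n}. root_char n (a * k)"
  have bij: "bij_betw (\<lambda>a. (a + 1) mod int n) {0..<int n} {0..<int n}"
    by (rule bij_betw_byWitness[where f' = "\<lambda>a. (a - 1) mod int n"])
      (use assms in \<open>auto simp: mod_simps\<close>)
  have "?S = (\<Sum>a\<in>{0..<int n}. root_char n ((a + 1) mod int n * k))"
    using sum.reindex_bij_betw[OF bij, of "\<lambda>a. root_char n (a * k)"] by simp
  also have "\<dots> = (\<Sum>a\<in>{0..<int n}. root_char n k * root_char n (a * k))"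
    by (intro sum.cong refl, subst root_char_add[symmetric], rule root_char_cong)
      (simp add: mod_simps algebra_simps)
  also have "\<dots> = root_char n k * ?S"
    by (simp add: sum_distrib_left)
  finally have "(1 - root_char n k) * ?S = 0" by (simp add: algebra_simps)
  then show ?thesis using False assms root_char_eq_1_iff[of n k] by auto
qed

text \<open>The angle \<open>t\<close> of the centred representative satisfies
  \<open>pi/2 \<le> |t| \<le> pi\<close>, and the squared distance from 1 to \<open>cis t\<close> is
  \<open>2 - 2 * cos t\<close>.\<close>

lemma norm_diff_root_char_ge:
  assumes "n > 0" "int n \<le> 4 * \<bar>centred n k\<bar>"
  shows "2 \<le> (cmod (1 - root_char n k))\<^sup>2"
proof -
  define t where "t = 2 * pi * of_int (centred n k) / of_nat n"
  have "root_char n k = cis t"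
    unfolding t_def root_char_def[symmetric] by (rule root_char_cong) simp
  have "0 \<le> k mod int n" "k mod int n < int n"
    using assms(1) by simp_all
  then have "\<bar>centred n k\<bar> * 2 \<le> int n"
    by (auto simp: centred_def)
  then have "real_of_int (\<bar>centred n k\<bar> * 2) \<le> of_int (int n)"
    "of_int (int n) \<le> real_of_int (4 * \<bar>centred n k\<bar>)"
    using assms(2) by (simp_all only: of_int_le_iff)
  then have "pi / 2 \<le> \<bar>t\<bar>" "\<bar>t\<bar> \<le> pi"
    using assms(1) by (simp_all add: t_def abs_mult field_simps)
  then have "cos \<bar>t\<bar> \<le> cos (pi / 2)"
    by (intro cos_monotone_0_pi_le) auto
  then have "cos t \<le> 0" by simp
  have "(cmod (1 - cis t))\<^sup>2 = 2 - 2 * cos t"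
    using sin_cos_squared_add[of t] by (simp add: cmod_power2 power2_diff)
  then show ?thesis
    using \<open>cos t \<le> 0\<close> \<open>root_char n k = cis t\<close> by simp
qed

section \<open>The transform in two dimensions: Parseval and intertwining relations\<close>

definition pairing :: "int \<times> int \<Rightarrow> int \<times> int \<Rightarrow> int" where
  "pairing p z = fst p * fst z + snd p * snd z"

text \<open>Unnormalised and with positive exponent; hence the factor \<open>n^2\<close> in
  Parseval's identity.\<close>

definition dft :: "nat \<Rightarrow> (int \<times> int \<Rightarrow> complex) \<Rightarrow> int \<times> int \<Rightarrow> complex" where
  "dft n f p = (\<Sum>z\<in>torus_verts n. f z * root_char n (pairing p z))"

text \<open>Orthogonality of characters: the sum factors into two one-dimensional character
  sums.\<close>

lemma sum_root_char_pairing: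
  assumes "n > 0" "z \<in> torus_verts n" "w \<in> torus_verts n"
  shows "(\<Sum>p\<in>torus_verts n. root_char n (pairing p z) * cnj (root_char n (pairing p w)))
    = (if z = w then (of_nat n)\<^sup>2 else 0)"
proof -
  obtain x y u v where zw: "z = (x, y)" "w = (u, v)" by force
  have dvd: "int n dvd a - b \<longleftrightarrow> a = b" if "a \<in> {0..<int n}" "b \<in> {0..<int n}" for a b
    using that by (auto simp: mod_eq_dvd_iff[symmetric])
  have "(\<Sum>p\<in>torus_verts n. root_char n (pairing p z) * cnj (root_char n (pairing p w)))
     = (\<Sum>(a, b)\<in>{0..<int n} \<times> {0..<int n}. root_char n (a * (x - u)) * root_char n (b * (y - v)))"
    unfolding torus_verts_def
    by (intro sum.cong)
      (auto simp: pairing_def zw cnj_root_char root_char_add[symmetric] algebra_simps)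
  also have "\<dots> = (\<Sum>a\<in>{0..<int n}. root_char n (a * (x - u))) * (\<Sum>b\<in>{0..<int n}. root_char n (b * (y - v)))"
    by (simp add: sum_product sum.cartesian_product)
  also have "\<dots> = (if z = w then (of_nat n)\<^sup>2 else 0)"
    using assms by (auto simp: sum_root_char dvd zw torus_verts_def power2_eq_square)
  finally show ?thesis .
qed

lemma parseval_dft:
  assumes "n > 0"
  shows "(\<Sum>p\<in>torus_verts n. (cmod (dft n f p))\<^sup>2) = (real n)\<^sup>2 * (\<Sum>z\<in>torus_verts n. (cmod (f z))\<^sup>2)"
proof -
  let ?V = "torus_verts n" and ?e = "\<lambda>p z. root_char n (pairing p z)"
  have "complex_of_real (\<Sum>p\<in>?V. (cmod (dft n f p))\<^sup>2) = (\<Sum>p\<in>?V. dft n f p * cnj (dft n f p))"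
    by (simp only: of_real_sum complex_norm_square)
  also have "\<dots> = (\<Sum>p\<in>?V. \<Sum>z\<in>?V. \<Sum>w\<in>?V. f z * cnj (f w) * (?e p z * cnj (?e p w)))"
    by (simp add: dft_def sum_product cnj_sum mult_ac)
  \<comment> \<open>With the sum over frequencies innermost, orthogonality leaves only the diagonal
    \<open>z = w\<close>.\<close>
  also have "\<dots> = (\<Sum>z\<in>?V. \<Sum>w\<in>?V. \<Sum>p\<in>?V. f z * cnj (f w) * (?e p z * cnj (?e p w)))"
    by (rule trans[OF sum.swap], rule sum.cong[OF refl], rule sum.swap)
  also have "\<dots> = (\<Sum>z\<in>?V. \<Sum>w\<in>?V. if z = w then (of_nat n)\<^sup>2 * (f z * cnj (f w)) else 0)"
    using assms by (intro sum.cong refl) (simp add: sum_root_char_pairing sum_distrib_left[symmetric])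
  also have "\<dots> = (\<Sum>z\<in>?V. (of_nat n)\<^sup>2 * (f z * cnj (f z)))"
    by (intro sum.cong refl) simp
  also have "\<dots> = complex_of_real ((real n)\<^sup>2 * (\<Sum>z\<in>?V. (cmod (f z))\<^sup>2))"
    by (simp only: sum_distrib_left of_real_sum of_real_mult complex_norm_square) simp
  finally show ?thesis by (simp only: of_real_eq_iff)
qed

text \<open>Change of variables along \<open>T\<close>. The phase \<open>c\<close> lets one rule
  serve shears (\<open>c = 1\<close>) and translations (\<open>q = p\<close>).\<close>

lemma dft_compose:
  assumes "bij_betw T (torus_verts n) (torus_verts n)"
    and "\<And>z. root_char n (pairing p z) = c * root_char n (pairing q (T z))"
  shows "dft n (\<lambda>z. f (T z)) p = c * dft n f q"
  using sum.reindex_bij_betw[OF assms(1), of "\<lambda>z. f z * root_char n (pairing q z)"]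
  by (simp add: dft_def assms(2) mult.left_commute[of _ c] flip: sum_distrib_left)

lemma dft_diff: "dft n (\<lambda>z. f z - g z) p = dft n f p - dft n g p"
  by (simp add: dft_def sum_subtractf left_diff_distrib)

text \<open>Modulo \<open>n\<close> the pairing is invariant when one argument is sheared and the
  other undergoes the inverse transpose shear; this exchanges horizontal and vertical.\<close>

lemma dft_shear:
  "dft n (\<lambda>z. f (vshear n (- 1) z)) p = dft n f (hshear n 1 p)"
  "dft n (\<lambda>z. f (hshear n (- 1) z)) p = dft n f (vshear n 1 p)"
proof -
  have *: "root_char n (pairing p z) = 1 * root_char n (pairing (hshear n 1 p) (vshear n (- 1) z))"
    "root_char n (pairing p z) = 1 * root_char n (pairing (vshear n 1 p) (hshear n (- 1) z))" for z
    unfolding mult_1_left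
    by (cases p; cases z; simp add: pairing_def hshear_def vshear_def root_char_add root_char_mult_mod;
        simp add: algebra_simps flip: root_char_add)+
  show "dft n (\<lambda>z. f (vshear n (- 1) z)) p = dft n f (hshear n 1 p)"
    using dft_compose[OF torus_maps_bij(2) *(1)] by simp
  show "dft n (\<lambda>z. f (hshear n (- 1) z)) p = dft n f (vshear n 1 p)"
    using dft_compose[OF torus_maps_bij(1) *(2)] by simp
qed

lemma dft_trans:
  "dft n (\<lambda>z. f (htrans n (- 1) z)) p = root_char n (fst p) * dft n f p"
  "dft n (\<lambda>z. f (vtrans n (- 1) z)) p = root_char n (snd p) * dft n f p"
proof -
  have *: "root_char n (pairing p z) = root_char n (fst p) * root_char n (pairing p (htrans n (- 1) z))"
    "root_char n (pairing p z) = root_char n (snd p) * root_char n (pairing p (vtrans n (- 1) z))" for z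
    by (cases p; cases z; simp add: pairing_def htrans_def vtrans_def root_char_add root_char_mult_mod;
        simp add: algebra_simps flip: root_char_add)+
  show "dft n (\<lambda>z. f (htrans n (- 1) z)) p = root_char n (fst p) * dft n f p"
    by (rule dft_compose[OF torus_maps_bij(3) *(1)])
  show "dft n (\<lambda>z. f (vtrans n (- 1) z)) p = root_char n (snd p) * dft n f p"
    by (rule dft_compose[OF torus_maps_bij(4) *(2)])
qed


section \<open>The spectral gap\<close>

lemma edge_sqdiff_nonneg: "e = {u, v} \<Longrightarrow> 0 \<le> edge_sqdiff f e"
  by (simp add: edge_sqdiff_doubleton)

lemma finite_graph_edges: "finite_graph G \<Longrightarrow> finite (edges G)"
  by (rule finite_subset[of _ "Pow (verts G)"]) (auto simp: finite_graph_def)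

text \<open>Group the vertices by the edge \<open>{z, T z}\<close>: an edge can arise only from its
  at most two endpoints.\<close>

lemma sum_map_le_edges:
  assumes G: "finite_graph G" and T: "\<And>z. z \<in> verts G \<Longrightarrow> {z, T z} \<in> edges G"
  shows "(\<Sum>z\<in>verts G. (cmod (f z - f (T z)))\<^sup>2) \<le> 2 * (\<Sum>e\<in>edges G. edge_sqdiff f e)"
proof -
  have "(\<Sum>z\<in>verts G. (cmod (f z - f (T z)))\<^sup>2)
      = (\<Sum>e\<in>edges G. \<Sum>z\<in>{z \<in> verts G. {z, T z} = e}. (cmod (f z - f (T z)))\<^sup>2)"
    using G T by (intro sum.group[symmetric] finite_graph_edges) (auto simp: finite_graph_def)
  also have "\<dots> = (\<Sum>e\<in>edges G. \<Sum>z\<in>{z \<in> verts G. {z, T z} = e}. edge_sqdiff f e)"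
    by (intro sum.cong) (auto simp: edge_sqdiff_doubleton)
  also have "\<dots> \<le> (\<Sum>e\<in>edges G. 2 * edge_sqdiff f e)"
  proof (rule sum_mono)
    fix e assume "e \<in> edges G"
    then obtain u v where e: "e = {u, v}" using G by (auto simp: finite_graph_def)
    have "card {z \<in> verts G. {z, T z} = e} \<le> card {u, v}"
      by (rule card_mono) (auto simp: e)
    also have "\<dots> \<le> 2" by (simp add: card_insert_if)
    finally have "real (card {z \<in> verts G. {z, T z} = e}) * edge_sqdiff f e \<le> 2 * edge_sqdiff f e"
      by (intro mult_right_mono edge_sqdiff_nonneg[OF e]) simp
    then show "(\<Sum>z\<in>{z \<in> verts G. {z, T z} = e}. edge_sqdiff f e) \<le> 2 * edge_sqdiff f e"
      by simp
  qed
  finally show ?thesis by (simp add: sum_distrib_left)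
qed

section \<open>Edges of the torus graph\<close>

lemma verts_torus_graph [simp]: "verts (torus_graph n) = torus_verts n"
  by (simp add: torus_graph_def)

text \<open>Written as the set of a list, so that the list length bounds the number of neighbours by
  8.\<close>

lemma torus_nbrs_eq:
  "torus_nbrs n z = set [vtrans n 1 z, vtrans n (- 1) z, htrans n 1 z, htrans n (- 1) z,
     vshear n 1 z, vshear n (- 1) z, hshear n 1 z, hshear n (- 1) z]"
  by (cases z) (simp add: torus_nbrs_def torus_maps)

lemma torus_nbrs_closed: "z \<in> torus_verts n \<Longrightarrow> w \<in> torus_nbrs n z \<Longrightarrow> w \<in> torus_verts n"
  by (auto simp: torus_nbrs_eq torus_maps_closed)

lemma torus_nbrs_sym: "z \<in> torus_verts n \<Longrightarrow> w \<in> torus_nbrs n z \<Longrightarrow> z \<in> torus_nbrs n w"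
  by (auto simp: torus_nbrs_eq torus_maps_inverse torus_maps_inverse[of _ n "- 1", simplified])

lemma finite_torus_graph: "finite_graph (torus_graph n)"
proof -
  have "\<exists>u\<in>torus_verts n. \<exists>v\<in>torus_verts n. e = {u, v}" if "e \<in> edges (torus_graph n)" for e
    using that torus_nbrs_closed by (fastforce simp: torus_graph_def)
  then show ?thesis by (simp add: finite_graph_def)
qed

lemma torus_maps_edges:
  assumes "z \<in> torus_verts n"
  shows "{z, hshear n (- 1) z} \<in> edges (torus_graph n)" "{z, vshear n (- 1) z} \<in> edges (torus_graph n)"
    "{z, htrans n (- 1) z} \<in> edges (torus_graph n)" "{z, vtrans n (- 1) z} \<in> edges (torus_graph n)"
proof -
  have *: "{z, w} \<in> edges (torus_graph n)" if "w \<in> torus_nbrs n z" for w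
    using assms that unfolding torus_graph_def by (simp del: split_paired_Ex) blast
  show "{z, hshear n (- 1) z} \<in> edges (torus_graph n)"
    "{z, vshear n (- 1) z} \<in> edges (torus_graph n)"
    "{z, htrans n (- 1) z} \<in> edges (torus_graph n)"
    "{z, vtrans n (- 1) z} \<in> edges (torus_graph n)"
    by (rule *, simp add: torus_nbrs_eq)+
qed

lemma torus_energy_ge:
  assumes n: "n > 0" and f: "(\<Sum>z\<in>torus_verts n. f z) = 0"
  shows "(\<Sum>z\<in>torus_verts n. (cmod (f z))\<^sup>2) \<le> 50 * (\<Sum>e\<in>edges (torus_graph n). edge_sqdiff f e)"
proof -
  let ?V = "torus_verts n" and ?E = "\<Sum>e\<in>edges (torus_graph n). edge_sqdiff f e"
  define F where "F = dft n f"
  \<comment> \<open>Parseval's identity for \<open>f - f o T\<close>.\<close>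
  have energy: "(\<Sum>p\<in>?V. (cmod (F p - dft n (\<lambda>z. f (T z)) p))\<^sup>2) \<le> (real n)\<^sup>2 * (2 * ?E)"
    if "\<And>z. z \<in> ?V \<Longrightarrow> {z, T z} \<in> edges (torus_graph n)" for T
  proof -
    have "(\<Sum>z\<in>?V. (cmod (f z - f (T z)))\<^sup>2) \<le> 2 * ?E"
      using sum_map_le_edges[OF finite_torus_graph[of n], where T = T and f = f] that by simp
    then show ?thesis
      by (simp add: F_def dft_diff[symmetric] parseval_dft[OF n] mult_left_mono del: mult_le_cancel_left)
  qed
  \<comment> \<open>The reverse triangle inequality passes from \<open>F\<close> to its modulus, to
    which the real shear inequality applies.\<close>
  have sqdiff: "(cmod a - cmod b)\<^sup>2 \<le> (cmod (a - b))\<^sup>2" for a b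
    using norm_triangle_ineq3[of a b] by (simp add: abs_le_square_iff[symmetric])
  have H: "(\<Sum>p\<in>?V. (cmod (F p) - cmod (F (hshear n 1 p)))\<^sup>2) \<le> (real n)\<^sup>2 * (2 * ?E)"
    by (rule order_trans[OF sum_mono[OF sqdiff]])
      (use energy[OF torus_maps_edges(2)] in \<open>simp add: dft_shear F_def\<close>)
  have K: "(\<Sum>p\<in>?V. (cmod (F p) - cmod (F (vshear n 1 p)))\<^sup>2) \<le> (real n)\<^sup>2 * (2 * ?E)"
    by (rule order_trans[OF sum_mono[OF sqdiff]])
      (use energy[OF torus_maps_edges(1)] in \<open>simp add: dft_shear F_def\<close>)
  have mult: "(cmod (F p - c * F p))\<^sup>2 = (cmod (1 - c))\<^sup>2 * (cmod (F p))\<^sup>2" for p c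
    by (simp add: norm_mult[symmetric] power_mult_distrib[symmetric] left_diff_distrib)
  have X: "(\<Sum>p\<in>?V. (cmod (1 - root_char n (fst p)))\<^sup>2 * (cmod (F p))\<^sup>2) \<le> (real n)\<^sup>2 * (2 * ?E)"
    using energy[OF torus_maps_edges(3)] by (simp add: dft_trans F_def[symmetric] mult)
  have Y: "(\<Sum>p\<in>?V. (cmod (1 - root_char n (snd p)))\<^sup>2 * (cmod (F p))\<^sup>2) \<le> (real n)\<^sup>2 * (2 * ?E)"
    using energy[OF torus_maps_edges(4)] by (simp add: dft_trans F_def[symmetric] mult)
  \<comment> \<open>At a far frequency at least one of the two character factors is at least 2.
    Adding \<open>X\<close> and \<open>Y\<close> and halving then bounds the far mass.\<close>
  have "(\<Sum>p\<in>?V. 2 * (of_bool (far n p) * (cmod (F p))\<^sup>2))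
      \<le> (\<Sum>p\<in>?V. (cmod (1 - root_char n (fst p)))\<^sup>2 * (cmod (F p))\<^sup>2
          + (cmod (1 - root_char n (snd p)))\<^sup>2 * (cmod (F p))\<^sup>2)"
  proof (rule sum_mono)
    fix p
    have "2 * of_bool (far n p) \<le> (cmod (1 - root_char n (fst p)))\<^sup>2 + (cmod (1 - root_char n (snd p)))\<^sup>2"
      using norm_diff_root_char_ge[OF n, of "fst p"] norm_diff_root_char_ge[OF n, of "snd p"]
      by (cases p) (auto simp: far_def add_increasing add_increasing2)
    from mult_right_mono[OF this, of "(cmod (F p))\<^sup>2"]
    show "2 * (of_bool (far n p) * (cmod (F p))\<^sup>2) \<le> (cmod (1 - root_char n (fst p)))\<^sup>2 * (cmod (F p))\<^sup>2
          + (cmod (1 - root_char n (snd p)))\<^sup>2 * (cmod (F p))\<^sup>2"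
      by (simp add: distrib_right mult.assoc)
  qed
  then have far: "(\<Sum>p\<in>?V. of_bool (far n p) * (cmod (F p))\<^sup>2) \<le> (real n)\<^sup>2 * (2 * ?E)"
    using X Y unfolding sum.distrib sum_distrib_left[symmetric] by linarith
  have "F (0, 0) = 0"
    using f by (simp add: F_def dft_def pairing_def)
  \<comment> \<open>Each of \<open>H\<close>, \<open>K\<close> and \<open>far\<close> contributes
    \<open>2 * ?E\<close>, and \<open>2 * (6 + 6 + 13) = 50\<close>.\<close>
  then have "(\<Sum>p\<in>?V. (cmod (F p))\<^sup>2) \<le> (real n)\<^sup>2 * (50 * ?E)"
    using shear_energy_ge[of "\<lambda>p. cmod (F p)" n] H K far by simp
  then show ?thesis
    using n by (simp add: F_def parseval_dft)
qed

text \<open>An edge at \<open>u\<close> may be listed from its other endpoint; symmetry of the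
  neighbour relation lets it be listed from \<open>u\<close>.\<close>

lemma degree_torus_graph_le:
  assumes u: "u \<in> torus_verts n"
  shows "degree (torus_graph n) u \<le> 8"
proof -
  have "card (torus_nbrs n u) \<le> 8"
    unfolding torus_nbrs_eq by (rule card_length[THEN order_trans]) simp
  moreover have "{e \<in> edges (torus_graph n). u \<in> e} \<subseteq> (\<lambda>v. {u, v}) ` torus_nbrs n u"
  proof
    fix e assume "e \<in> {e \<in> edges (torus_graph n). u \<in> e}"
    then obtain p q where "e = {p, q}" "p \<in> torus_verts n" "q \<in> torus_nbrs n p" "u = p \<or> u = q"
      by (auto simp: torus_graph_def)
    then show "e \<in> (\<lambda>v. {u, v}) ` torus_nbrs n u"
      using torus_nbrs_sym[of p n q] by (auto simp: insert_commute)
  qed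
  then have "degree (torus_graph n) u \<le> card (torus_nbrs n u)"
    unfolding degree_def by (intro surj_card_le) (simp add: torus_nbrs_eq)
  ultimately show ?thesis by simp
qed

text \<open>Functions vanishing off the vertex set form a compact set, so a minimiser exists among those
  of norm 1; without one, \<open>LEAST\<close> would be unspecified.\<close>

lemma lambda2_attained:
  assumes G: "finite_graph G" "2 \<le> card (verts G)"
  shows "\<exists>f. (\<exists>u\<in>verts G. f u \<noteq> 0) \<and> (\<Sum>u\<in>verts G. f u) = 0 \<and> lambda2 G = rayleigh G f"
proof -
  let ?V = "verts G"
  let ?num = "\<lambda>f. \<Sum>e\<in>edges G. edge_sqdiff f e" and ?den = "\<lambda>f. \<Sum>u\<in>?V. (cmod (f u))\<^sup>2"
  have finV: "finite ?V" using G by (simp add: finite_graph_def)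
  \<comment> \<open>Fixing the value 0 off \<open>?V\<close> makes the product compact by Tychonoff
    for any vertex type; radius 1 suffices since \<open>?den f = 1\<close>.\<close>
  define K where "K = {f. (\<Sum>u\<in>?V. f u) = 0} \<inter> {f. ?den f = 1}
    \<inter> PiE UNIV (\<lambda>u. if u \<in> ?V then cball 0 1 else {0 :: complex})"
  have cont: "continuous_on UNIV (\<lambda>f :: 'a \<Rightarrow> complex. f u)" for u
    by simp
  have "compact (PiE UNIV (\<lambda>u. if u \<in> ?V then cball 0 1 else {0 :: complex}))"
    by (subst compactin_euclidean_iff[symmetric], subst euclidean_product_topology[symmetric])
      (auto simp: compactin_PiE)
  moreover have "closed {f. (\<Sum>u\<in>?V. f u) = (0 :: complex)}" "closed {f. ?den f = 1}"
    by (intro closed_Collect_eq continuous_intros cont)+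
  ultimately have "compact K"
    unfolding K_def by (intro closed_Int_compact closed_Int)
  moreover have "continuous_on K ?num"
  proof (rule continuous_on_sum)
    fix e assume "e \<in> edges G"
    then obtain u v where "e = {u, v}" using G by (auto simp: finite_graph_def)
    then show "continuous_on K (\<lambda>f. edge_sqdiff f e)"
      by (auto simp: edge_sqdiff_doubleton intro!: continuous_intros continuous_on_subset[OF cont])
  qed
  \<comment> \<open>The quotient is invariant under scaling and under changes off \<open>?V\<close>,
    so every competitor has a normalised copy in \<open>K\<close>.\<close>
  moreover have scale: "\<exists>g\<in>K. ?num g = rayleigh G f"
    if "u \<in> ?V" "f u \<noteq> 0" and f0: "(\<Sum>u\<in>?V. f u) = 0" for f u
  proof -
    define r where "r = sqrt (?den f)"
    define g where "g = (\<lambda>u. if u \<in> ?V then f u / of_real r else 0)"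
    have "?den f > 0"
      using that finV by (intro sum_pos2[of _ u]) auto
    then have r: "r > 0" "r\<^sup>2 = ?den f" by (auto simp: r_def)
    have "?den g = ?den f / r\<^sup>2"
      by (simp add: g_def norm_divide power_divide sum_divide_distrib)
    then have den: "?den g = 1" using r \<open>?den f > 0\<close> by simp
    have "cmod (g v) \<le> 1" if "v \<in> ?V" for v
      using member_le_sum[OF that, of "\<lambda>v. (cmod (g v))\<^sup>2"] finV den by (simp add: power_le_one_iff)
    moreover have "(\<Sum>u\<in>?V. g u) = 0"
      using f0 by (simp add: g_def sum_divide_distrib[symmetric])
    ultimately have "g \<in> K"
      using den by (auto simp: K_def g_def)
    have "edge_sqdiff g e = edge_sqdiff f e / r\<^sup>2" if "e \<in> edges G" for e
    proof -
      have "\<exists>u\<in>?V. \<exists>v\<in>?V. e = {u, v}"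
        using that G(1) by (simp add: finite_graph_def)
      then obtain u v where "e = {u, v}" "u \<in> ?V" "v \<in> ?V" by blast
      then show ?thesis
        by (simp add: edge_sqdiff_doubleton g_def norm_divide power_divide flip: diff_divide_distrib)
    qed
    then have "?num g = rayleigh G f"
      by (simp add: rayleigh_def r sum_divide_distrib)
    then show ?thesis using \<open>g \<in> K\<close> by blast
  qed
  moreover have "K \<noteq> {}"
  proof -
    obtain u v where uv: "u \<in> ?V" "v \<in> ?V" "u \<noteq> v"
      using G(2) by (metis card_le_Suc0_iff_eq finV not_less_eq_eq numeral_2_eq_2)
    \<comment> \<open>A difference of two point masses has sum zero; this needs two distinct
      vertices.\<close>
    define f :: "'a \<Rightarrow> complex" where "f = (\<lambda>w. (if w = u then 1 else 0) - (if w = v then 1 else 0))"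
    have "f u \<noteq> 0" "(\<Sum>u\<in>?V. f u) = 0"
      using uv finV by (simp_all add: f_def sum_subtractf)
    then show ?thesis using scale uv by blast
  qed
  ultimately obtain g where g: "g \<in> K" "\<And>h. h \<in> K \<Longrightarrow> ?num g \<le> ?num h"
    using continuous_attains_inf[of K ?num] by blast
  have g0: "\<exists>u\<in>?V. g u \<noteq> 0" "(\<Sum>u\<in>?V. g u) = 0" "rayleigh G g = ?num g"
    using g(1) by (auto simp: K_def rayleigh_def intro: ccontr)
  have "lambda2 G = rayleigh G g"
    unfolding lambda2_def
  proof (rule Least_equality)
    show "\<exists>f. (\<exists>u\<in>?V. f u \<noteq> 0) \<and> (\<Sum>u\<in>?V. f u) = 0 \<and> rayleigh G g = rayleigh G f"
      using g0 by blast
    show "rayleigh G g \<le> q"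
      if "\<exists>f. (\<exists>u\<in>?V. f u \<noteq> 0) \<and> (\<Sum>u\<in>?V. f u) = 0 \<and> q = rayleigh G f" for q
      using that scale g(2) g0(3) by metis
  qed
  then show ?thesis using g0 by blast
qed

section \<open>The gap constant and the expander family\<close>

lemma card_torus_verts: "card (torus_verts n) = n * n"
  by (simp add: torus_verts_def card_cartesian_product)

lemma two_le_card_torus_verts: "2 \<le> n \<Longrightarrow> 2 \<le> card (torus_verts n)"
  using mult_le_mono[of 2 n 1 n] by (simp add: card_torus_verts)

lemma lambda2_torus_ge:
  assumes "2 \<le> n"
  shows "1/50 \<le> lambda2 (torus_graph n)"
proof -
  obtain f u where f: "u \<in> torus_verts n" "f u \<noteq> 0" "(\<Sum>u\<in>torus_verts n. f u) = 0"
    "lambda2 (torus_graph n) = rayleigh (torus_graph n) f"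
    using lambda2_attained[OF finite_torus_graph, of n] two_le_card_torus_verts[OF assms] by auto
  have "(\<Sum>u\<in>torus_verts n. (cmod (f u))\<^sup>2) > 0"
    using f by (intro sum_pos2[of _ u]) auto
  then show ?thesis
    using torus_energy_ge[of n f] f(3) assms by (simp add: f(4) rayleigh_def pos_le_divide_eq)
qed

theorem theorem2p3:
  "(\<exists>c::real. c > 0 \<and> (\<forall>n::nat. n \<ge> 2 \<longrightarrow> lambda2 (torus_graph n) \<ge> c)) \<and>
   expander_family {n::nat. n \<ge> 2} torus_graph"
proof -
  have gap: "\<exists>c::real. c > 0 \<and> (\<forall>n\<ge>2. c \<le> lambda2 (torus_graph n))"
    using lambda2_torus_ge by (intro exI[of _ "1/50"]) simp
  \<comment> \<open>The vertex count \<open>n * n\<close> determines \<open>n\<close>, so the family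
    contains infinitely many graphs.\<close>
  have "inj torus_graph"
  proof (rule injI)
    fix m n assume "torus_graph m = torus_graph n"
    then have "card (verts (torus_graph m)) = card (verts (torus_graph n))" by simp
    then show "m = n" by (simp add: card_torus_verts flip: power2_eq_square)
  qed
  then have "infinite (torus_graph ` {n. n \<ge> 2})"
    using infinite_Ici[of "2::nat"] by (metis atLeast_def finite_imageD inj_on_subset subset_UNIV)
  moreover have "\<exists>d. \<forall>n\<in>{n. 2 \<le> n}. \<forall>u\<in>verts (torus_graph n). degree (torus_graph n) u \<le> d"
    using degree_torus_graph_le by (intro exI[of _ 8]) simp
  ultimately show ?thesis
    using gap by (simp add: expander_family_def finite_torus_graph two_le_card_torus_verts)
qed

end
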